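(* Let $q$ be a prime power, $E=\mathbb{F}_q^n$, and let $F_1,\dots,F_t$ be a shelling of a shellable $q$-complex $\Delta$ on $E$. For $i=0,1,\dots,t$ let $\Delta_i=\langle F_1,\dots,F_i\rangle$ (so $\Delta_0=\emptyset$). Then for every $1\le i\le t$, $$\Delta_i=I_i\cup\Delta_{i-1}\quad\text{and}\quad I_i\cap\Delta_{i-1}=\emptyset.$$ Consequently $\Delta$ is the disjoint union $\Delta=\coprod_{i=1}^t I_i$.
   Context: A $q$-complex on $E$ is a set of subspaces of $E$ closed under taking subspaces; facets are its inclusion-maximal elements; it is pure if all facets have equal dimension. For a set $\mathcal{A}$ of subspaces, $\langle\mathcal{A}\rangle$ is the set of subspaces contained in some member of $\mathcal{A}$ (and $\langle\emptyset\rangle=\emptyset$). A shelling is a linear order $F_1,\dots,F_t$ of the facets of a pure $q$-complex such that for each $j\ge2$, $\langle F_j\rangle\cap\langle F_1,\dots,F_{j-1}\rangle$ is generated by a nonempty set of subspaces of $F_j$ of dimension $\dim F_j-1$; shellable means pure and admitting a shelling. For $1\le j<i\le t$ define $\mathcal{R}_{i,j}=\{x\in F_i:\langle x\rangle\oplus(F_i\cap F_j)=F_i\}$, and for $1\le i\le t$ define $I_i=\{A\in\langle F_i\rangle: A\cap\mathcal{R}_{i,j}\ne\emptyset\text{ whenever }1\le j<i\text{ and }\mathcal{R}_{i,j}\ne\emptyset\}$. *)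

theory Defs
  imports "HOL-Analysis.Cartesian_Space" "HOL-Library.Disjoint_Sets"
begin

text \<open>
  The ambient space \<open>E\<close> is \<open>'a ^ 'n\<close> with \<open>'a\<close> a finite field, so that
  \<open>q = CARD('a)\<close> and \<open>n = CARD('n)\<close>.
\<close>

definition q_complex :: "('a::{field,finite} ^ 'n) set set \<Rightarrow> bool" where
  "q_complex \<Delta> \<longleftrightarrow>
     (\<forall>A\<in>\<Delta>. vec.subspace A) \<and>
     (\<forall>A\<in>\<Delta>. \<forall>B. vec.subspace B \<and> B \<subseteq> A \<longrightarrow> B \<in> \<Delta>)"

definition q_facets :: "('a::{field,finite} ^ 'n) set set \<Rightarrow> ('a ^ 'n) set set" where
  "q_facets \<Delta> = {A \<in> \<Delta>. \<forall>B\<in>\<Delta>. A \<subseteq> B \<longrightarrow> A = B}"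

definition q_pure :: "('a::{field,finite} ^ 'n) set set \<Rightarrow> bool" where
  "q_pure \<Delta> \<longleftrightarrow> (\<forall>A\<in>q_facets \<Delta>. \<forall>B\<in>q_facets \<Delta>. vec.dim A = vec.dim B)"

definition q_gen :: "('a::{field,finite} ^ 'n) set set \<Rightarrow> ('a ^ 'n) set set" where
  "q_gen \<A> = {B. vec.subspace B \<and> (\<exists>A\<in>\<A>. B \<subseteq> A)}"

text \<open>
  The facets are listed as \<open>F 1, \<dots>, F t\<close>; values of \<open>F\<close> outside \<open>{1..t}\<close> are irrelevant.
  The codimension-one condition is written with addition to avoid truncated subtraction.
\<close>

definition q_shelling ::
  "('a::{field,finite} ^ 'n) set set \<Rightarrow> nat \<Rightarrow> (nat \<Rightarrow> ('a ^ 'n) set) \<Rightarrow> bool" where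
  "q_shelling \<Delta> t F \<longleftrightarrow>
     q_complex \<Delta> \<and> q_pure \<Delta> \<and> bij_betw F {1..t} (q_facets \<Delta>) \<and>
     (\<forall>j\<in>{2..t}. \<exists>\<H>. \<H> \<noteq> {} \<and>
        (\<forall>H\<in>\<H>. vec.subspace H \<and> H \<subseteq> F j \<and> vec.dim H + 1 = vec.dim (F j)) \<and>
        q_gen {F j} \<inter> q_gen (F ` {1..<j}) = q_gen \<H>)"

definition q_shellable :: "('a::{field,finite} ^ 'n) set set \<Rightarrow> bool" where
  "q_shellable \<Delta> \<longleftrightarrow> q_complex \<Delta> \<and> q_pure \<Delta> \<and> (\<exists>t F. q_shelling \<Delta> t F)"

definition internal_direct_sum ::
  "('a::field ^ 'n) set \<Rightarrow> ('a ^ 'n) set \<Rightarrow> ('a ^ 'n) set \<Rightarrow> bool" where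
  "internal_direct_sum U V W \<longleftrightarrow> {u + v |u v. u \<in> U \<and> v \<in> V} = W \<and> U \<inter> V = {0}"

definition shelling_R ::
  "(nat \<Rightarrow> ('a::{field,finite} ^ 'n) set) \<Rightarrow> nat \<Rightarrow> nat \<Rightarrow> ('a ^ 'n) set" where
  "shelling_R F i j = {x \<in> F i. internal_direct_sum (vec.span {x}) (F i \<inter> F j) (F i)}"

definition shelling_I ::
  "(nat \<Rightarrow> ('a::{field,finite} ^ 'n) set) \<Rightarrow> nat \<Rightarrow> ('a ^ 'n) set set" where
  "shelling_I F i =
     {A \<in> q_gen {F i}. \<forall>j. 1 \<le> j \<and> j < i \<and> shelling_R F i j \<noteq> {} \<longrightarrow> A \<inter> shelling_R F i j \<noteq> {}}"

definition shelling_Delta ::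
  "(nat \<Rightarrow> ('a::{field,finite} ^ 'n) set) \<Rightarrow> nat \<Rightarrow> ('a ^ 'n) set set" where
  "shelling_Delta F i = q_gen (F ` {1..i})"

end

theory Submission imports Defs begin

text \<open>
  For distinct facets, \<open>R\<^sub>i\<^sub>j\<close> is either empty or equal to \<open>F\<^sub>i - F\<^sub>j\<close>, and it is nonempty as soon as
  \<open>F\<^sub>i \<inter> F\<^sub>j\<close> contains a hyperplane of \<open>F\<^sub>i\<close>. Hence a subspace of \<open>F\<^sub>i\<close> outside \<open>I\<^sub>i\<close> lies in some
  earlier facet. Conversely, by the shelling condition a subspace of \<open>F\<^sub>i\<close> lying in an earlier
  facet is contained in a hyperplane \<open>H = F\<^sub>i \<inter> F\<^sub>k\<close> with \<open>k < i\<close>, so it misses \<open>R\<^sub>i\<^sub>k = F\<^sub>i - H\<close>.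
\<close>

text \<open>As \<open>x\<close> lies outside \<open>V\<close>, its line meets \<open>V\<close> only
  in 0, so directness is automatic and only spanning is left. The elementwise form lets another
  vector be substituted for \<open>x\<close> by arithmetic.\<close>

lemma internal_direct_sum_line_iff:
  fixes U V :: "('a::field ^ 'n) set"
  assumes U: "vec.subspace U" and V: "vec.subspace V" and x: "x \<in> U" "x \<notin> V"
  shows "internal_direct_sum (vec.span {x}) (U \<inter> V) U \<longleftrightarrow> (\<forall>z\<in>U. \<exists>c. z - c *s x \<in> V)"
proof
  assume ds: "internal_direct_sum (vec.span {x}) (U \<inter> V) U"
  show "\<forall>z\<in>U. \<exists>c. z - c *s x \<in> V"
  proof
    fix z assume "z \<in> U"
    with ds have "z \<in> {u + v |u v. u \<in> vec.span {x} \<and> v \<in> U \<inter> V}"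
      unfolding internal_direct_sum_def by blast
    then obtain c v where "z = c *s x + v" "v \<in> V" by (auto simp: vec.span_singleton)
    then have "z - c *s x \<in> V" by simp
    then show "\<exists>c. z - c *s x \<in> V" ..
  qed
next
  assume *: "\<forall>z\<in>U. \<exists>c. z - c *s x \<in> V"
  have "U \<subseteq> {u + v |u v. u \<in> vec.span {x} \<and> v \<in> U \<inter> V}"
  proof
    fix z assume z: "z \<in> U"
    with * obtain c where "z - c *s x \<in> V" by blast
    moreover have "z - c *s x \<in> U" using U x z by (simp add: vec.subspace_diff vec.subspace_scale)
    moreover have "z = c *s x + (z - c *s x)" by simp
    moreover have "c *s x \<in> vec.span {x}" by (auto simp: vec.span_singleton)
    ultimately show "z \<in> {u + v |u v. u \<in> vec.span {x} \<and> v \<in> U \<inter> V}" by blast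
  qed
  moreover have "{u + v |u v. u \<in> vec.span {x} \<and> v \<in> U \<inter> V} \<subseteq> U"
    using U x by (auto simp: vec.span_singleton intro!: vec.subspace_add vec.subspace_scale)
  moreover have "c = 0" if "c *s x \<in> V" for c
  proof (rule ccontr)
    assume "c \<noteq> 0"
    \<comment> \<open>Scaling by \<open>inverse c\<close> would put \<open>x\<close> itself into
      \<open>V\<close>.\<close>
    with vec.subspace_scale[OF V that, of "inverse c"] x show False by simp
  qed
  then have "vec.span {x} \<inter> (U \<inter> V) = {0}"
    using U V by (auto simp: vec.span_singleton vec.subspace_0 vec.span_zero)
  ultimately show "internal_direct_sum (vec.span {x}) (U \<inter> V) U"
    unfolding internal_direct_sum_def by blast
qed

text \<open>A generator inside \<open>V\<close> would lie in both summands, hence be 0; the sum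
  would then collapse to \<open>U \<inter> V\<close>.\<close>

lemma internal_direct_sum_line_notin:
  fixes U V :: "('a::field ^ 'n) set"
  assumes ds: "internal_direct_sum (vec.span {x}) (U \<inter> V) U"
    and "x \<in> U" and nsub: "\<not> U \<subseteq> V"
  shows "x \<notin> V"
proof
  assume "x \<in> V"
  with \<open>x \<in> U\<close> have "x \<in> vec.span {x} \<inter> (U \<inter> V)" by (simp add: vec.span_base)
  with ds have "x = 0" unfolding internal_direct_sum_def by blast
  with ds have "{v \<in> U. v \<in> V} = U" by (simp add: internal_direct_sum_def vec.span_insert_0)
  with nsub show False by blast
qed

text \<open>A single element of \<open>shelling_R F i j\<close> shows that
  \<open>F i \<inter> F j\<close> is a hyperplane of \<open>F i\<close>; every vector of
  \<open>F i\<close> off a hyperplane spans a complement of it.\<close>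

lemma shelling_R_eq_Diff:
  assumes Fi: "vec.subspace (F i)" and Fj: "vec.subspace (F j)" and nsub: "\<not> F i \<subseteq> F j"
    and ne: "shelling_R F i j \<noteq> {}"
  shows "shelling_R F i j = F i - F j"
proof
  show "shelling_R F i j \<subseteq> F i - F j"
    using internal_direct_sum_line_notin[OF _ _ nsub] by (auto simp: shelling_R_def)
  from ne obtain x where x: "x \<in> F i" "internal_direct_sum (vec.span {x}) (F i \<inter> F j) (F i)"
    by (auto simp: shelling_R_def)
  then have "x \<notin> F j" using internal_direct_sum_line_notin nsub by blast
  with x internal_direct_sum_line_iff[OF Fi Fj]
  have dec: "\<forall>z\<in>F i. \<exists>c. z - c *s x \<in> F j" by blast
  show "F i - F j \<subseteq> shelling_R F i j"
  proof
    fix y assume y: "y \<in> F i - F j"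
    with dec obtain c where c: "y - c *s x \<in> F j" by blast
    \<comment> \<open>\<open>c = 0\<close> would put \<open>y\<close> into
      \<open>F j\<close>.\<close>
    with y have "c \<noteq> 0" by auto
    have "\<exists>e. z - e *s y \<in> F j" if "z \<in> F i" for z
    proof -
      from dec that obtain d where d: "z - d *s x \<in> F j" by blast
      \<comment> \<open>The factor \<open>d / c\<close> is chosen to cancel the \<open>x\<close>
        terms, so \<open>d / c\<close> is the coefficient of \<open>z\<close> along
        \<open>y\<close>.\<close>
      have "(z - d *s x) - (d / c) *s (y - c *s x) \<in> F j"
        using c d Fj by (simp add: vec.subspace_diff vec.subspace_scale)
      also have "(z - d *s x) - (d / c) *s (y - c *s x) = z - (d / c) *s y"
        using \<open>c \<noteq> 0\<close> by (simp add: vec_eq_iff field_simps)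
      finally show ?thesis by blast
    qed
    with y internal_direct_sum_line_iff[OF Fi Fj] show "y \<in> shelling_R F i j"
      by (auto simp: shelling_R_def)
  qed
qed

text \<open>Any \<open>x\<close> in \<open>F i\<close> outside \<open>F j\<close> is also outside
  \<open>H\<close>, so by dimension \<open>H\<close> and \<open>x\<close> together span
  \<open>F i\<close>; as \<open>H\<close> lies in \<open>F j\<close>, the line of \<open>x\<close>
  is a complement.\<close>

lemma shelling_R_nonempty:
  assumes Fi: "vec.subspace (F i)" and Fj: "vec.subspace (F j)" and nsub: "\<not> F i \<subseteq> F j"
    and H: "vec.subspace H" "H \<subseteq> F i \<inter> F j" "vec.dim H + 1 = vec.dim (F i)"
  shows "shelling_R F i j \<noteq> {}"
proof -
  from nsub obtain x where x: "x \<in> F i" "x \<notin> F j" by blast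
  then have "x \<notin> vec.span H" using H vec.span_eq_iff by blast
  then have "vec.dim (F i) \<le> vec.dim (insert x H)"
    using H(3) by (simp add: vec.dim_insert)
  then have "vec.span (insert x H) = vec.span (F i)"
    using x H(2) by (intro vec.dim_eq_span) auto
  then have "F i = vec.span (insert x H)" using Fi vec.span_eq_iff by blast
  \<comment> \<open>Splitting off the multiple of \<open>x\<close> leaves an element of
    \<open>vec.span H\<close>, which is \<open>H\<close>.\<close>
  then have "\<exists>c. z - c *s x \<in> H" if "z \<in> F i" for z
    using that vec.span_breakdown_eq[of z x H] H(1) by (simp add: vec.span_eq_iff[THEN iffD2])
  then have "\<forall>z\<in>F i. \<exists>c. z - c *s x \<in> F j" using H(2) by blast
  with x internal_direct_sum_line_iff[OF Fi Fj] show ?thesis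
    by (auto simp: shelling_R_def)
qed

text \<open>The ambient space is finite, so every member of the complex lies in a maximal
  one.\<close>

lemma q_complex_eq_q_gen_facets:
  assumes "q_complex \<Delta>"
  shows "\<Delta> = q_gen (q_facets \<Delta>)"
proof
  show "q_gen (q_facets \<Delta>) \<subseteq> \<Delta>"
    using assms by (auto simp: q_gen_def q_facets_def q_complex_def)
  show "\<Delta> \<subseteq> q_gen (q_facets \<Delta>)"
  proof
    fix A assume A: "A \<in> \<Delta>"
    have "\<exists>B\<in>\<Delta>. A \<subseteq> B \<and> (\<forall>C\<in>\<Delta>. B \<subseteq> C \<longrightarrow> B = C)"
      by (rule finite_has_maximal2[OF finite A])
    then obtain B where "B \<in> \<Delta>" "A \<subseteq> B" "\<forall>C\<in>\<Delta>. B \<subseteq> C \<longrightarrow> B = C" by blast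
    then have "B \<in> q_facets \<Delta>" unfolding q_facets_def by blast
    moreover have "vec.subspace A" using A assms unfolding q_complex_def by blast
    ultimately show "A \<in> q_gen (q_facets \<Delta>)"
      using \<open>A \<subseteq> B\<close> unfolding q_gen_def by blast
  qed
qed

text \<open>Supplies the hypotheses of the lemmas on \<open>shelling_R\<close>. By maximality an
  inclusion between facets is an equality, which injectivity of the enumeration excludes.\<close>

lemma q_shelling_facets:
  assumes "q_shelling \<Delta> t F" and i: "i \<in> {1..t}"
  shows "vec.subspace (F i)"
    and "\<And>j. j \<in> {1..t} \<Longrightarrow> j \<noteq> i \<Longrightarrow> \<not> F i \<subseteq> F j"
proof -
  have bij: "bij_betw F {1..t} (q_facets \<Delta>)" and "q_complex \<Delta>"
    using assms by (auto simp: q_shelling_def)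
  have mem: "F j \<in> q_facets \<Delta>" if "j \<in> {1..t}" for j
    using bij that bij_betwE by blast
  show "vec.subspace (F i)"
    using mem[OF i] \<open>q_complex \<Delta>\<close> by (auto simp: q_facets_def q_complex_def)
  show "\<not> F i \<subseteq> F j" if "j \<in> {1..t}" "j \<noteq> i" for j
  proof
    assume "F i \<subseteq> F j"
    with mem[OF i] mem[OF that(1)] have "F i = F j" by (auto simp: q_facets_def)
    with inj_onD[OF bij_betw_imp_inj_on[OF bij]] i that show False by blast
  qed
qed

lemma shelling_Delta_step:
  assumes sh: "q_shelling \<Delta> t F" and i: "i \<in> {1..t}"
  shows "shelling_Delta F i = shelling_I F i \<union> shelling_Delta F (i - 1)"
proof
  have "{1..i} = insert i {1..i - 1}" using i by auto
  then have split: "shelling_Delta F i = q_gen {F i} \<union> shelling_Delta F (i - 1)"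
    by (auto simp: shelling_Delta_def q_gen_def)
  then show "shelling_I F i \<union> shelling_Delta F (i - 1) \<subseteq> shelling_Delta F i"
    by (auto simp: shelling_I_def)
  have "A \<in> shelling_Delta F (i - 1)" if A: "A \<in> q_gen {F i}" "A \<notin> shelling_I F i" for A
  proof -
    from A obtain j where j: "1 \<le> j" "j < i" "shelling_R F i j \<noteq> {}" "A \<inter> shelling_R F i j = {}"
      by (auto simp: shelling_I_def)
    have "j \<in> {1..t}" using j i by auto
    then have "shelling_R F i j = F i - F j"
      using q_shelling_facets[OF sh] i j by (intro shelling_R_eq_Diff) auto
    \<comment> \<open>\<open>A\<close> lies in \<open>F i\<close> and misses
      \<open>F i - F j\<close>.\<close>
    with A j have "vec.subspace A" "A \<subseteq> F j" by (auto simp: q_gen_def)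
    moreover have "j \<in> {1..i - 1}" using j by auto
    ultimately show ?thesis by (auto simp: shelling_Delta_def q_gen_def)
  qed
  with split show "shelling_Delta F i \<subseteq> shelling_I F i \<union> shelling_Delta F (i - 1)" by blast
qed

lemma shelling_I_disjoint_Delta:
  assumes sh: "q_shelling \<Delta> t F" and i: "i \<in> {1..t}"
  shows "shelling_I F i \<inter> shelling_Delta F (i - 1) = {}"
proof (rule ccontr)
  assume "shelling_I F i \<inter> shelling_Delta F (i - 1) \<noteq> {}"
  then obtain A where A: "A \<in> shelling_I F i" "A \<in> shelling_Delta F (i - 1)" by blast
  have ivl: "{1..i - 1} = {1..<i}" using i by auto
  \<comment> \<open>For \<open>i = 1\<close> there is no earlier facet to contain \<open>A\<close>;
    the shelling condition starts at index 2.\<close>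
  from A(2) have "i \<in> {2..t}" using i by (auto simp: shelling_Delta_def q_gen_def)
  with sh obtain \<H> where
    \<H>: "\<forall>H\<in>\<H>. vec.subspace H \<and> H \<subseteq> F i \<and> vec.dim H + 1 = vec.dim (F i)"
    and gen: "q_gen {F i} \<inter> q_gen (F ` {1..<i}) = q_gen \<H>"
    unfolding q_shelling_def by blast
  have "A \<in> q_gen \<H>" using A gen ivl by (auto simp: shelling_I_def shelling_Delta_def)
  then obtain H where H: "H \<in> \<H>" "A \<subseteq> H" by (auto simp: q_gen_def)
  \<comment> \<open>The generator \<open>H\<close> belongs to the complex it generates, so one
    earlier facet contains all of \<open>H\<close>, not only \<open>A\<close>.\<close>
  then have "H \<in> q_gen \<H>" using \<H> by (auto simp: q_gen_def)
  then have "H \<in> q_gen (F ` {1..<i})" using gen by blast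
  then obtain k where k: "1 \<le> k" "k < i" "H \<subseteq> F k" by (auto simp: q_gen_def)
  then have kt: "k \<in> {1..t}" using i by auto
  have nsub: "\<not> F i \<subseteq> F k" using q_shelling_facets(2)[OF sh i kt] k by simp
  note sub = q_shelling_facets(1)[OF sh i] q_shelling_facets(1)[OF sh kt]
  have ne: "shelling_R F i k \<noteq> {}"
    using shelling_R_nonempty[OF sub nsub, of H] \<H> H k by blast
  then have "A \<inter> shelling_R F i k \<noteq> {}" using A k by (auto simp: shelling_I_def)
  \<comment> \<open>\<open>A \<subseteq> H \<subseteq> F k\<close>, yet \<open>A\<close> would have
    to meet \<open>F i - F k\<close>.\<close>
  with shelling_R_eq_Diff[OF sub nsub ne] H k show False by blast
qed

theorem theorem5p10:
  fixes \<Delta> :: "('a::{field,finite} ^ 'n) set set"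
    and F :: "nat \<Rightarrow> ('a ^ 'n) set"
    and t :: nat
  assumes "q_shellable \<Delta>"
    and "q_shelling \<Delta> t F"
  shows "(\<forall>i\<in>{1..t}. shelling_Delta F i = shelling_I F i \<union> shelling_Delta F (i - 1) \<and>
                     shelling_I F i \<inter> shelling_Delta F (i - 1) = {}) \<and>
         \<Delta> = (\<Union>i\<in>{1..t}. shelling_I F i) \<and>
         disjoint_family_on (shelling_I F) {1..t}"
proof (intro conjI ballI)
  fix i assume i: "i \<in> {1..t}"
  show "shelling_Delta F i = shelling_I F i \<union> shelling_Delta F (i - 1)"
    using shelling_Delta_step[OF assms(2) i] .
  show "shelling_I F i \<inter> shelling_Delta F (i - 1) = {}"
    using shelling_I_disjoint_Delta[OF assms(2) i] .
next
  have "shelling_Delta F m = (\<Union>i\<in>{1..m}. shelling_I F i)" if "m \<le> t" for m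
    using that
  proof (induction m)
    case 0
    \<comment> \<open>The empty family generates nothing, not even the zero subspace.\<close>
    show ?case by (simp add: shelling_Delta_def q_gen_def)
  next
    case (Suc m)
    with shelling_Delta_step[OF assms(2), of "Suc m"] show ?case
      by (simp add: atLeastAtMostSuc_conv)
  qed
  moreover have "\<Delta> = shelling_Delta F t"
    using q_complex_eq_q_gen_facets assms(2)
    by (auto simp: q_shelling_def shelling_Delta_def bij_betw_def)
  ultimately show "\<Delta> = (\<Union>i\<in>{1..t}. shelling_I F i)" by simp
next
  \<comment> \<open>The earlier block is contained in \<open>shelling_Delta F (j - 1)\<close>, from
    which the block of \<open>j\<close> is already known to be disjoint.\<close>
  have "shelling_I F i \<inter> shelling_I F j = {}" if "i \<in> {1..t}" "j \<in> {1..t}" "i < j" for i j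
  proof -
    have "i \<in> {1..j - 1}" using that by auto
    then have "shelling_I F i \<subseteq> shelling_Delta F (j - 1)"
      by (auto simp: shelling_I_def shelling_Delta_def q_gen_def)
    with shelling_I_disjoint_Delta[OF assms(2) that(2)] show ?thesis by blast
  qed
  then show "disjoint_family_on (shelling_I F) {1..t}"
    unfolding disjoint_family_on_def by (metis Int_commute linorder_neqE_nat)
qed

end
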